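(* Let $a>0$, $r\ge1$. Let $f$ be a continuously differentiable function on $\mathbb R_+$ with $f(0)=0$, and suppose that there exist numbers $0\le\gamma_1<\gamma_2\le1$ and a constant $\lambda>0$ such that $|f'(x)|\ge\lambda$ for all $x\in[\gamma_1a,\gamma_2a]$. Then there is a constant $\kappa>0$ depending only on $\gamma_1,\gamma_2,\lambda$ such that $$\inf_{T_{n,f}}\ \sup_{\Sigma\in\mathcal S(a,r)}\mathbb E_\Sigma^{1/2}\bigl(T_{n,f}(X_1,\dots,X_n)-\tau_f(\Sigma)\bigr)^2\ \ge\ \kappa\,a\sqrt{\frac rn},$$ where the infimum is taken over all estimators $T_{n,f}(X_1,\dots,X_n)$ of $\tau_f(\Sigma)$.
   Context: $\mathbb H$ is a separable Hilbert space. Covariance operators are self-adjoint positive semidefinite trace class operators on $\mathbb H$; $\|\Sigma\|$ is the operator norm and ${\bf r}(\Sigma):={\rm tr}(\Sigma)/\|\Sigma\|$ the effective rank. $\mathcal S(a,r):=\{\Sigma:\|\Sigma\|\le a,\ {\bf r}(\Sigma)\le r\}$, $a>0$, $r\ge 1$. Under $\mathbb E_\Sigma$, $X_1,\dots,X_n$ are i.i.d. $N(0,\Sigma)$ in $\mathbb H$. $\tau_f(\Sigma):={\rm tr}(f(\Sigma))=\sum_jf(\lambda_j(\Sigma))$ (eigenvalues with multiplicity). $\mathbb R_+=[0,\infty)$. An estimator is a measurable real-valued function of the observations; $\mathbb E^{1/2}Y^2$ means $(\mathbb EY^2)^{1/2}$.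
   Formalization: The condition r ≤ dim H (automatic when H is infinite-dimensional) is added; without it the claim fails, e.g. for dim H = 1, f(x) = x, fixed n and r → ∞, where the risk stays bounded while κa√(r/n) grows. *)

theory Defs
  imports "HOL-Probability.Probability"
begin

section \<open>Covariance operators\<close>

text \<open>A Hilbert space is a type of class \<open>{real_inner, complete_space}\<close>; adding
  \<open>second_countable_topology\<close> makes it separable.\<close>

definition orthonormal_basis :: "'a::real_inner set \<Rightarrow> bool" where
  "orthonormal_basis B \<longleftrightarrow>
     pairwise orthogonal B \<and> (\<forall>e\<in>B. norm e = 1) \<and> closure (span B) = UNIV"

text \<open>For a positive semidefinite operator neither membership in the trace class nor the
  value of the trace depends on the basis.\<close>

definition covariance_operator :: "('a::real_inner \<Rightarrow> 'a) \<Rightarrow> bool" where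
  "covariance_operator A \<longleftrightarrow>
     bounded_linear A \<and>
     (\<forall>x y. A x \<bullet> y = x \<bullet> A y) \<and>
     (\<forall>x. 0 \<le> A x \<bullet> x) \<and>
     (\<forall>B. orthonormal_basis B \<longrightarrow> (\<lambda>e. A e \<bullet> e) summable_on B)"

definition op_trace :: "('a::real_inner \<Rightarrow> 'a) \<Rightarrow> real" where
  "op_trace A = (\<Sum>\<^sub>\<infinity>e\<in>(SOME B. orthonormal_basis B). A e \<bullet> e)"

definition effective_rank :: "('a::real_inner \<Rightarrow> 'a) \<Rightarrow> real" where
  "effective_rank A = op_trace A / onorm A"

text \<open>The Hilbert space \<open>H\<close> is a closed subspace of the ambient type, and a self-adjoint
  operator on \<open>H\<close> is identified with its extension by \<open>0\<close> to the orthogonal complement of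
  \<open>H\<close>, i.e. with a self-adjoint operator whose range lies in \<open>H\<close>. The extension does not
  change operator norm, trace or nonzero eigenvalues. This makes it possible to quantify over
  \<open>H\<close> inside a formula; \<open>H = UNIV\<close> is the plain case. The zero operator is left out since
  its effective rank is undefined.\<close>

definition cov_class :: "'a::real_inner set \<Rightarrow> real \<Rightarrow> real \<Rightarrow> ('a \<Rightarrow> 'a) set" where
  "cov_class H a r =
     {S. covariance_operator S \<and> range S \<subseteq> H \<and> S \<noteq> (\<lambda>x. 0) \<and>
         onorm S \<le> a \<and> effective_rank S \<le> r}"

text \<open>The sum of \<open>f\<close> over the eigenvalues, with multiplicity. The eigenvalue \<open>0\<close>, whose
  multiplicity may be infinite, is dropped: the functional is only used for \<open>f 0 = 0\<close>. The
  nonzero eigenvalues of a trace class operator have finite multiplicity, so that \<open>dim\<close> is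
  the multiplicity.\<close>

definition trace_functional :: "(real \<Rightarrow> real) \<Rightarrow> ('a::real_inner \<Rightarrow> 'a) \<Rightarrow> real" where
  "trace_functional f A =
     (\<Sum>\<^sub>\<infinity>l\<in>{l. l \<noteq> 0 \<and> (\<exists>x. x \<noteq> 0 \<and> A x = l *\<^sub>R x)}.
        real (dim {x. A x = l *\<^sub>R x}) * f l)"

section \<open>Gaussian measures and estimation risk\<close>

definition centered_normal :: "real \<Rightarrow> real measure" where
  "centered_normal v =
     (if v = 0 then return borel 0 else density lborel (\<lambda>x. ennreal (normal_density 0 (sqrt v) x)))"

text \<open>\<open>M\<close> is the law \<open>N(0, S)\<close>: every one-dimensional projection \<open>\<langle>X, u\<rangle>\<close> is
  normal with mean \<open>0\<close> and variance \<open>\<langle>S u, u\<rangle>\<close>.\<close>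

definition centered_gaussian :: "'a::real_inner measure \<Rightarrow> ('a \<Rightarrow> 'a) \<Rightarrow> bool" where
  "centered_gaussian M S \<longleftrightarrow>
     prob_space M \<and> sets M = sets borel \<and>
     (\<forall>u. distr M borel (\<lambda>x. x \<bullet> u) = centered_normal (S u \<bullet> u))"

definition estimators :: "nat \<Rightarrow> ((nat \<Rightarrow> 'a::real_inner) \<Rightarrow> real) set" where
  "estimators n = borel_measurable (Pi\<^sub>M {..<n} (\<lambda>_. borel))"

definition ennsqrt :: "ennreal \<Rightarrow> ennreal" where
  "ennsqrt x = (if x = \<top> then \<top> else ennreal (sqrt (enn2real x)))"

text \<open>The root mean squared error (possibly infinite) of \<open>T(X\<^sub>1,\<dots>,X\<^sub>n)\<close> as an estimator of
  \<open>\<theta>\<close>, for \<open>X\<^sub>1,\<dots>,X\<^sub>n\<close> independent with law \<open>M\<close>.\<close>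

definition rmse ::
  "nat \<Rightarrow> 'a::real_inner measure \<Rightarrow> ((nat \<Rightarrow> 'a) \<Rightarrow> real) \<Rightarrow> real \<Rightarrow> ennreal" where
  "rmse n M T \<theta> = ennsqrt (\<integral>\<^sup>+X. ennreal ((T X - \<theta>)\<^sup>2) \<partial>Pi\<^sub>M {..<n} (\<lambda>_. M))"

text \<open>Each covariance operator \<open>S\<close> is the covariance of exactly one centered Gaussian measure,
  so the innermost supremum is just the evaluation at \<open>M = N(0, S)\<close>. That measure is
  concentrated on \<open>H\<close>, and measurable functions on \<open>H\<^sup>n\<close> are the restrictions of measurable
  functions on the ambient product.\<close>

definition minimax_rmse ::
  "'a::real_inner set \<Rightarrow> real \<Rightarrow> real \<Rightarrow> nat \<Rightarrow> (real \<Rightarrow> real) \<Rightarrow> ennreal" where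
  "minimax_rmse H a r n f =
     (INF T\<in>estimators n. SUP S\<in>cov_class H a r. SUP M\<in>{M. centered_gaussian M S}.
        rmse n M T (trace_functional f S))"

end

theory Submission
  imports Defs
begin

text \<open>Le Cam's two-point method on multiples of a projection. Let \<open>P\<close> be the orthogonal
  projection onto a subspace of \<open>H\<close> of dimension \<open>d = \<lfloor>r\<rfloor>\<close>. The operator \<open>s P\<close> has effective rank
  \<open>d\<close> and \<open>\<tau>\<^sub>f(s P) = d f(s)\<close>, and \<open>n\<close> observations from \<open>N(0, s P)\<close> carry the same information as
  \<open>n d\<close> real observations from \<open>N(0, s)\<close>. Hence \<open>s = \<gamma>\<^sub>2 a\<close> cannot be told from \<open>s (1 - t)\<close>
  when \<open>t\<close> is a small multiple of \<open>1 / sqrt (n d)\<close>, while by the mean value theorem the functional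
  differs by at least \<open>d \<lambda> s t\<close>, which is of order \<open>a sqrt (d / n)\<close>.\<close>

section \<open>Orthonormal systems and projections\<close>

definition orthonormal :: "'a::real_inner set \<Rightarrow> bool" where
  "orthonormal C \<longleftrightarrow> pairwise orthogonal C \<and> (\<forall>e\<in>C. norm e = 1)"

text \<open>For infinite \<open>C\<close> the sum is \<open>0\<close> by convention, hence the
  frequent assumption \<open>finite C\<close> below.\<close>

definition orth_proj :: "'a::real_inner set \<Rightarrow> 'a \<Rightarrow> 'a" where
  "orth_proj C x = (\<Sum>c\<in>C. (x \<bullet> c) *\<^sub>R c)"

lemma orthonormal_subset: "orthonormal C \<Longrightarrow> D \<subseteq> C \<Longrightarrow> orthonormal D"
  unfolding orthonormal_def by (meson pairwise_subset subsetD)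

lemma orthonormal_inner:
  assumes "orthonormal C" "b \<in> C" "c \<in> C"
  shows "b \<bullet> c = (if b = c then 1 else 0)"
  using assms unfolding orthonormal_def pairwise_def orthogonal_def
  by (auto simp: dot_square_norm)

lemma orthonormal_independent:
  assumes "orthonormal C"
  shows "independent C"
proof (rule pairwise_orthogonal_independent)
  show "pairwise orthogonal C" "0 \<notin> C"
    using assms unfolding orthonormal_def by auto
qed

lemma orth_proj_in_span: "orth_proj C x \<in> span C"
  unfolding orth_proj_def by (intro span_sum span_scale span_base)

lemma orth_proj_inner:
  assumes "finite C" "orthonormal C" "c \<in> C"
  shows "orth_proj C x \<bullet> c = x \<bullet> c"
proof -
  have "orth_proj C x \<bullet> c = (\<Sum>b\<in>C. (x \<bullet> b) * (b \<bullet> c))"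
    unfolding orth_proj_def inner_sum_left by simp
  also have "\<dots> = (\<Sum>b\<in>C. if b = c then x \<bullet> b else 0)"
    using assms by (intro sum.cong refl) (simp add: orthonormal_inner)
  finally show ?thesis
    using assms by simp
qed

lemma orth_proj_residual_orthogonal:
  assumes "finite C" "orthonormal C" "y \<in> span C"
  shows "orthogonal (x - orth_proj C x) y"
proof (rule orthogonal_to_span[OF assms(3)])
  show "orthogonal (x - orth_proj C x) c" if "c \<in> C" for c
    using orth_proj_inner[OF assms(1,2) that]
    by (simp add: orthogonal_def inner_diff_left)
qed

text \<open>The residual lies in the span and is orthogonal to it, hence orthogonal to
  itself.\<close>

lemma orth_proj_on_span:
  assumes "finite C" "orthonormal C" "x \<in> span C"
  shows "orth_proj C x = x"
proof -
  have "orthogonal (x - orth_proj C x) (x - orth_proj C x)"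
    by (intro orth_proj_residual_orthogonal assms span_diff orth_proj_in_span)
  then show ?thesis
    by (simp add: orthogonal_def)
qed

lemma inner_orth_proj_self: "orth_proj C x \<bullet> x = (\<Sum>c\<in>C. (x \<bullet> c)\<^sup>2)"
  unfolding orth_proj_def inner_sum_left by (simp add: power2_eq_square inner_commute)

lemma norm_residual_orth_proj:
  assumes "finite C" "orthonormal C"
  shows "(norm (x - orth_proj C x))\<^sup>2 = (norm x)\<^sup>2 - (\<Sum>c\<in>C. (x \<bullet> c)\<^sup>2)"
proof -
  have "(x - orth_proj C x) \<bullet> orth_proj C x = 0"
    using orth_proj_residual_orthogonal[OF assms orth_proj_in_span]
    by (simp add: orthogonal_def)
  then have "(norm (x - orth_proj C x))\<^sup>2 = x \<bullet> x - orth_proj C x \<bullet> x"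
    unfolding power2_norm_eq_inner by (simp add: inner_diff_left inner_diff_right)
  then show ?thesis
    by (simp add: inner_orth_proj_self power2_norm_eq_inner)
qed

text \<open>Best approximation: \<open>x - y\<close> splits into the residual and a vector of the
  span, so Pythagoras applies.\<close>

lemma norm_residual_orth_proj_le:
  assumes "finite C" "orthonormal C" "y \<in> span C"
  shows "norm (x - orth_proj C x) \<le> norm (x - y)"
proof -
  have "(norm ((x - orth_proj C x) + (orth_proj C x - y)))\<^sup>2
      = (norm (x - orth_proj C x))\<^sup>2 + (norm (orth_proj C x - y))\<^sup>2"
    by (intro norm_add_Pythagorean orth_proj_residual_orthogonal assms span_diff orth_proj_in_span)
  then have "(norm (x - orth_proj C x))\<^sup>2 \<le> (norm (x - y))\<^sup>2"
    by simp
  then show ?thesis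
    by (rule power2_le_imp_le) simp
qed

lemma Bessel_inequality:
  assumes "finite C" "orthonormal C"
  shows "(\<Sum>c\<in>C. (x \<bullet> c)\<^sup>2) \<le> (norm x)\<^sup>2"
  using norm_residual_orth_proj[OF assms, of x] zero_le_power2[of "norm (x - orth_proj C x)"]
  by linarith

lemma norm_orth_proj_le:
  assumes "finite C" "orthonormal C"
  shows "norm (orth_proj C x) \<le> norm x"
proof -
  have "orth_proj C x \<bullet> orth_proj C x = orth_proj C x \<bullet> x"
    using orth_proj_residual_orthogonal[OF assms orth_proj_in_span, of x x]
    by (simp add: orthogonal_def inner_diff_left inner_diff_right inner_commute)
  then have "(norm (orth_proj C x))\<^sup>2 \<le> (norm x)\<^sup>2"
    using Bessel_inequality[OF assms, of x] by (simp add: power2_norm_eq_inner inner_orth_proj_self)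
  then show ?thesis
    by (rule power2_le_imp_le) simp
qed

section \<open>Parseval's identity and the trace of a projection\<close>

text \<open>Bessel bounds all finite partial sums. For the converse, density puts \<open>x\<close>
  within \<open>sqrt \<epsilon>\<close> of the span of some finite \<open>F\<close>, and the
  projection onto that span is at least as close.\<close>

lemma Parseval:
  fixes B :: "'a::real_inner set"
  assumes "orthonormal_basis B"
  shows "((\<lambda>e. (x \<bullet> e)\<^sup>2) has_sum (norm x)\<^sup>2) B"
proof -
  have B: "orthonormal B" and dense: "closure (span B) = UNIV"
    using assms unfolding orthonormal_basis_def orthonormal_def by auto
  let ?f = "\<lambda>e. (x \<bullet> e)\<^sup>2"
  have upper: "sum ?f F \<le> (norm x)\<^sup>2" if "finite F" "F \<subseteq> B" for F
    using Bessel_inequality[OF that(1) orthonormal_subset[OF B that(2)]] .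
  have summable: "?f summable_on B"
    using upper by (intro nonneg_bdd_above_summable_on bdd_aboveI[of _ "(norm x)\<^sup>2"]) auto
  have "(norm x)\<^sup>2 \<le> infsum ?f B"
  proof (rule field_le_epsilon)
    fix \<epsilon> :: real assume "\<epsilon> > 0"
    then obtain y where y: "y \<in> span B" "dist y x < sqrt \<epsilon>"
      using dense closure_approachable[of x "span B"] by (auto dest: spec[of _ "sqrt \<epsilon>"])
    then obtain F where F: "finite F" "F \<subseteq> B" "y \<in> span F"
      unfolding span_explicit by blast
    have F': "orthonormal F"
      using orthonormal_subset[OF B F(2)] .
    have "norm (x - orth_proj F x) \<le> sqrt \<epsilon>"
      using norm_residual_orth_proj_le[OF F(1) F' F(3), of x] y(2)
      by (simp add: dist_norm norm_minus_commute)
    then have "(norm (x - orth_proj F x))\<^sup>2 \<le> \<epsilon>"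
      using \<open>\<epsilon> > 0\<close> by (simp add: sqrt_ge_absD)
    moreover have "sum ?f F \<le> infsum ?f B"
      by (rule finite_sum_le_infsum) (use summable F in auto)
    ultimately show "(norm x)\<^sup>2 \<le> infsum ?f B + \<epsilon>"
      using norm_residual_orth_proj[OF F(1) F', of x] by linarith
  qed
  moreover have "infsum ?f B \<le> (norm x)\<^sup>2"
    using summable upper by (rule infsum_le_finite_sums)
  ultimately show ?thesis
    using summable by (simp add: has_sum_iff)
qed

text \<open>The finite sum over \<open>C\<close> is exchanged with the sum over \<open>B\<close>; by
  Parseval each unit vector contributes 1. The basis is arbitrary because
  \<open>covariance_operator\<close> asks for summability over every one.\<close>

lemma has_sum_orth_proj_trace:
  assumes "orthonormal_basis B" "finite C" "orthonormal C"
  shows "((\<lambda>e. orth_proj C e \<bullet> e) has_sum real (card C)) B"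
proof -
  have "((\<lambda>e. \<Sum>c\<in>C. (c \<bullet> e)\<^sup>2) has_sum (\<Sum>c\<in>C. (norm c)\<^sup>2)) B"
    using assms(2) by induction (simp_all add: has_sum_add Parseval[OF assms(1)])
  moreover have "(\<Sum>c\<in>C. (norm c)\<^sup>2) = real (card C)"
    using assms(3) by (simp add: orthonormal_def)
  ultimately show ?thesis
    unfolding inner_orth_proj_self by (simp add: inner_commute)
qed

lemma bounded_linear_orth_proj: "bounded_linear (orth_proj C)"
  unfolding orth_proj_def[abs_def]
  by (intro bounded_linear_sum bounded_linear_scaleR_left[THEN bounded_linear_compose]
      bounded_linear_inner_left)

lemma orth_proj_self_adjoint: "orth_proj C x \<bullet> y = x \<bullet> orth_proj C y"
  unfolding orth_proj_def inner_sum_left inner_sum_right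
  by (simp add: inner_commute mult.commute)

lemma covariance_operator_orth_proj:
  fixes C :: "'a::real_inner set"
  assumes "finite C" "orthonormal C" "s \<ge> 0"
  shows "covariance_operator (\<lambda>x. s *\<^sub>R orth_proj C x)"
  unfolding covariance_operator_def
proof (intro conjI allI impI)
  show "bounded_linear (\<lambda>x. s *\<^sub>R orth_proj C x)"
    by (intro bounded_linear_orth_proj bounded_linear_const_scaleR)
  show "(s *\<^sub>R orth_proj C x) \<bullet> y = x \<bullet> s *\<^sub>R orth_proj C y" for x y
    by (simp add: orth_proj_self_adjoint)
  show "0 \<le> (s *\<^sub>R orth_proj C x) \<bullet> x" for x
    using assms(3) by (simp add: inner_orth_proj_self sum_nonneg)
  show "(\<lambda>e. (s *\<^sub>R orth_proj C e) \<bullet> e) summable_on B" if "orthonormal_basis B" for B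
    using has_sum_orth_proj_trace[OF that assms(1,2)]
    by (auto intro!: summable_on_cmult_right simp: has_sum_iff)
qed

section \<open>Gram-Schmidt orthonormalisation\<close>

text \<open>One Gram-Schmidt step. The first span inclusion keeps the new vector inside a given
  subspace, the second makes the process exhaust a given sequence.\<close>

lemma orthonormal_extend:
  fixes C :: "'a::real_inner set"
  assumes C: "finite C" "orthonormal C" and x: "x \<notin> span C"
  obtains e where "e \<notin> C" "orthonormal (insert e C)" "e \<in> span (insert x C)"
    "x \<in> span (insert e C)"
proof -
  define y where "y = x - orth_proj C x"
  define e where "e = y /\<^sub>R norm y"
  have y0: "y \<noteq> 0"
    using x orth_proj_in_span[of C x] unfolding y_def by auto
  have orth: "orthogonal e c" if "c \<in> span C" for c
    using orth_proj_residual_orthogonal[OF C that, of x]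
    unfolding e_def y_def by (simp add: orthogonal_clauses)
  have norm_e: "norm e = 1"
    using y0 by (simp add: e_def)
  show ?thesis
  proof
    show "e \<notin> C"
      using orth[of e] norm_e by (auto simp: span_base orthogonal_def)
    show "orthonormal (insert e C)"
      using C(2) norm_e orth unfolding orthonormal_def
      by (auto simp: pairwise_insert span_base orthogonal_commute)
    have sp: "orth_proj C x \<in> span (insert z C)" for z
      using orth_proj_in_span span_mono[of C "insert z C"] by blast
    show "e \<in> span (insert x C)"
      unfolding e_def y_def by (intro span_scale span_diff sp span_base) simp
    have "x = norm y *\<^sub>R e + orth_proj C x"
      using y0 by (simp add: e_def y_def)
    moreover have "norm y *\<^sub>R e + orth_proj C x \<in> span (insert e C)"
      by (intro span_add span_scale sp span_base) simp
    ultimately show "x \<in> span (insert e C)"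
      by simp
  qed
qed

text \<open>While \<open>C\<close> has fewer elements than \<open>B\<close>, the independent set
  \<open>B\<close> cannot lie in \<open>span C\<close>, so some \<open>b\<close> in it feeds another
  Gram-Schmidt step. Staying in \<open>span B\<close> later places \<open>C\<close> inside the
  subspace \<open>H\<close>.\<close>

lemma orthonormal_in_span:
  fixes B :: "'a::real_inner set"
  assumes B: "finite B" "independent B" and "k \<le> card B"
  obtains C where "finite C" "orthonormal C" "card C = k" "C \<subseteq> span B"
proof -
  have "\<exists>C. finite C \<and> orthonormal C \<and> card C = k \<and> C \<subseteq> span B"
    using \<open>k \<le> card B\<close>
  proof (induction k)
    case 0
    then show ?case
      by (intro exI[of _ "{}"]) (simp add: orthonormal_def)
  next
    case (Suc k)
    then obtain C where C: "finite C" "orthonormal C" "card C = k" "C \<subseteq> span B"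
      by auto
    have "\<not> B \<subseteq> span C"
      using independent_span_bound[OF C(1) B(2)] C(3) Suc.prems by auto
    then obtain b where b: "b \<in> B" "b \<notin> span C"
      by blast
    obtain e where e: "e \<notin> C" "orthonormal (insert e C)" "e \<in> span (insert b C)"
      using orthonormal_extend[OF C(1,2) b(2)] by metis
    have "insert b C \<subseteq> span B"
      using b(1) C(4) by (simp add: span_base)
    then have "e \<in> span B"
      using e(3) span_mono[of "insert b C" "span B"] by (auto simp: span_span)
    then show ?case
      using C e by (intro exI[of _ "insert e C"]) simp
  qed
  then show ?thesis
    using that by blast
qed

text \<open>Ensures that the \<open>SOME\<close> in \<open>op_trace\<close> picks a genuine basis.
  Gram-Schmidt along a countable dense set gives an increasing chain of finite systems whose union
  has dense span.\<close>

lemma orthonormal_basis_exists: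
  "\<exists>B :: 'a::{real_inner, second_countable_topology} set. orthonormal_basis B"
proof -
  obtain D :: "'a set" where D: "countable D" "\<And>X. open X \<Longrightarrow> X \<noteq> {} \<Longrightarrow> \<exists>d\<in>D. d \<in> X"
    using countable_dense_setE by blast
  have "D \<noteq> {}"
    using D(2)[of UNIV] by auto
  define d where "d = from_nat_into D"
  let ?P = "\<lambda>n C. finite C \<and> orthonormal C"
  let ?Q = "\<lambda>n C C'. C \<subseteq> C' \<and> d n \<in> span C'"
  have "\<exists>F. \<forall>n. ?P n (F n) \<and> ?Q n (F n) (F (Suc n))"
  proof (rule dependent_nat_choice)
    show "\<exists>C::'a set. ?P 0 C"
      by (intro exI[of _ "{}"]) (simp add: orthonormal_def)
    fix C :: "'a set" and n assume C: "?P n C"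
    show "\<exists>C'. ?P (Suc n) C' \<and> ?Q n C C'"
    proof (cases "d n \<in> span C")
      case False
      then show ?thesis
        using orthonormal_extend[of C "d n"] C by (metis finite_insert subset_insertI)
    qed (use C in blast)
  qed
  then obtain F where F: "\<And>n. orthonormal (F n)"
    "\<And>n. F n \<subseteq> F (Suc n)" "\<And>n. d n \<in> span (F (Suc n))"
    by blast
  have mono: "F m \<subseteq> F n" if "m \<le> n" for m n
    using F(2) that by (rule lift_Suc_mono_le)
  \<comment> \<open>The systems form a chain, so orthogonality of two vectors of the union can be
    read off from a single \<open>F n\<close>.\<close>
  have two: "\<exists>n. x \<in> F n \<and> y \<in> F n" if "x \<in> F i" "y \<in> F j" for x y i j
    using mono[of i "max i j"] mono[of j "max i j"] that by (intro exI[of _ "max i j"]) auto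
  have pair: "orthogonal x y" if "x \<in> (\<Union>n. F n)" "y \<in> (\<Union>n. F n)" "x \<noteq> y" for x y
    using that two F(1) unfolding orthonormal_def pairwise_def by (metis UN_E)
  have "D \<subseteq> span (\<Union>n. F n)"
  proof
    fix x assume "x \<in> D"
    then obtain n where "x = d n"
      using D(1) from_nat_into_surj unfolding d_def by metis
    then show "x \<in> span (\<Union>n. F n)"
      using F(3)[of n] span_mono[of "F (Suc n)" "\<Union>n. F n"] by blast
  qed
  moreover have "closure D = UNIV"
  proof -
    have "x \<in> closure D" for x
      unfolding closure_iff_nhds_not_empty using D(2)
      by (metis IntI empty_iff interior_subset open_interior subsetD)
    then show ?thesis
      by auto
  qed
  ultimately have "closure (span (\<Union>n. F n)) = UNIV"
    using closure_mono by blast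
  then have "orthonormal_basis (\<Union>n. F n)"
    unfolding orthonormal_basis_def
    using pair F(1) by (auto simp: pairwise_def orthonormal_def)
  then show ?thesis ..
qed

section \<open>Trace, norm and eigenvalues of multiples of a projection\<close>

lemma op_trace_orth_proj:
  fixes C :: "'a::{real_inner, second_countable_topology} set"
  assumes "finite C" "orthonormal C"
  shows "op_trace (\<lambda>x. s *\<^sub>R orth_proj C x) = s * real (card C)"
proof -
  have "orthonormal_basis (SOME B::'a set. orthonormal_basis B)"
    using orthonormal_basis_exists by (rule someI_ex)
  from has_sum_orth_proj_trace[OF this assms] show ?thesis
    unfolding op_trace_def by (simp add: infsum_cmult_right' has_sum_iff)
qed

lemma onorm_orth_proj:
  assumes "finite C" "orthonormal C" "C \<noteq> {}" "s \<ge> 0"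
  shows "onorm (\<lambda>x. s *\<^sub>R orth_proj C x) = s"
proof (rule antisym)
  show "onorm (\<lambda>x. s *\<^sub>R orth_proj C x) \<le> s"
    using norm_orth_proj_le[OF assms(1,2)] assms(4)
    by (intro onorm_bound) (auto simp: mult_left_mono)
  obtain c where c: "c \<in> C"
    using assms(3) by blast
  have "norm (s *\<^sub>R orth_proj C c) \<le> onorm (\<lambda>x. s *\<^sub>R orth_proj C x) * norm c"
    by (intro onorm bounded_linear_orth_proj bounded_linear_const_scaleR)
  then show "s \<le> onorm (\<lambda>x. s *\<^sub>R orth_proj C x)"
    using c assms by (simp add: orth_proj_on_span span_base orthonormal_def)
qed

lemma orth_proj_in_cov_class:
  fixes C :: "'a::{real_inner, second_countable_topology} set"
  assumes C: "finite C" "orthonormal C" "C \<noteq> {}"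
    and H: "subspace H" "C \<subseteq> H" and "0 < s" "s \<le> a" "real (card C) \<le> r"
  shows "(\<lambda>x. s *\<^sub>R orth_proj C x) \<in> cov_class H a r"
proof -
  let ?S = "\<lambda>x. s *\<^sub>R orth_proj C x"
  have norm_S: "onorm ?S = s"
    using C \<open>0 < s\<close> by (intro onorm_orth_proj) auto
  then have "?S \<noteq> (\<lambda>x. 0)"
    using \<open>0 < s\<close> onorm_zero by (metis less_irrefl)
  moreover have "range ?S \<subseteq> H"
    using orth_proj_in_span[of C] span_minimal[OF H(2,1)] H(1)
    by (auto intro!: subspace_scale)
  moreover have "effective_rank ?S = real (card C)"
    using \<open>0 < s\<close> unfolding effective_rank_def norm_S op_trace_orth_proj[OF C(1,2)] by simp
  ultimately show ?thesis
    unfolding cov_class_def using covariance_operator_orth_proj[OF C(1,2)] norm_S assms by simp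
qed

text \<open>An eigenvector for an eigenvalue \<open>l \<noteq> 0\<close> is \<open>s / l\<close>
  times its own projection, so it lies in the span, where the operator acts as \<open>s\<close>.
  Thus \<open>s\<close> is the only nonzero eigenvalue, with multiplicity
  \<open>card C\<close>.\<close>

lemma trace_functional_orth_proj:
  fixes C :: "'a::real_inner set"
  assumes C: "finite C" "orthonormal C" "C \<noteq> {}" and "s > 0"
  shows "trace_functional f (\<lambda>x. s *\<^sub>R orth_proj C x) = real (card C) * f s"
proof -
  let ?S = "\<lambda>x. s *\<^sub>R orth_proj C x"
  have eigenspace: "{x. ?S x = s *\<^sub>R x} = span C"
    using \<open>s > 0\<close> orth_proj_on_span[OF C(1,2)] orth_proj_in_span[of C] by auto metis
  have "l = s" if "l \<noteq> 0" "x \<noteq> 0" "?S x = l *\<^sub>R x" for l x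
  proof -
    have "x = (1 / l) *\<^sub>R (l *\<^sub>R x)"
      using that by simp
    also have "\<dots> = (s / l) *\<^sub>R orth_proj C x"
      unfolding that(3)[symmetric] by simp
    finally have "x = (s / l) *\<^sub>R orth_proj C x" .
    then have "x \<in> span C"
      using orth_proj_in_span span_scale by metis
    then show ?thesis
      using that orth_proj_on_span[OF C(1,2)] by simp
  qed
  moreover obtain c where "c \<in> C"
    using C(3) by blast
  then have "c \<noteq> 0" "?S c = s *\<^sub>R c"
    using C by (auto simp: orth_proj_on_span span_base orthonormal_def)
  ultimately have "{l. l \<noteq> 0 \<and> (\<exists>x. x \<noteq> 0 \<and> ?S x = l *\<^sub>R x)} = {s}"
    using \<open>s > 0\<close> by blast
  moreover have "dim (span C) = card C"
    using orthonormal_independent[OF C(2)] by (simp add: dim_span dim_eq_card_independent)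
  ultimately show ?thesis
    unfolding trace_functional_def by (simp del: scaleR_cancel_left add: eigenspace)
qed

section \<open>Hellinger affinity\<close>

text \<open>Rectangles determine a finite product measure; the indicator of a rectangle factorises
  as the density does, so Tonelli splits the integral.\<close>

lemma PiM_density:
  fixes M :: "'i \<Rightarrow> 'a measure"
  assumes I: "finite I" and M: "\<And>i. prob_space (M i)"
    and h: "\<And>i. h i \<in> borel_measurable (M i)" and D: "\<And>i. prob_space (density (M i) (h i))"
  shows "density (PiM I M) (\<lambda>x. \<Prod>i\<in>I. h i (x i)) = PiM I (\<lambda>i. density (M i) (h i))"
proof -
  interpret M: product_prob_space M
    using M by (rule product_prob_spaceI)
  interpret D: product_prob_space "\<lambda>i. density (M i) (h i)"
    using D by (rule product_prob_spaceI)
  note h[measurable]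
  show ?thesis
  proof (rule D.PiM_eqI[OF I])
    show "sets (density (PiM I M) (\<lambda>x. \<Prod>i\<in>I. h i (x i))) = sets (PiM I (\<lambda>i. density (M i) (h i)))"
      by (simp cong: sets_PiM_cong)
    fix A assume "\<And>i. i \<in> I \<Longrightarrow> A i \<in> sets (density (M i) (h i))"
    then have A[measurable]: "\<And>i. i \<in> I \<Longrightarrow> A i \<in> sets (M i)"
      by simp
    have "emeasure (density (PiM I M) (\<lambda>x. \<Prod>i\<in>I. h i (x i))) (Pi\<^sub>E I A)
        = (\<integral>\<^sup>+x. (\<Prod>i\<in>I. h i (x i)) * indicator (Pi\<^sub>E I A) x \<partial>PiM I M)"
      using A I by (intro emeasure_density) (auto intro!: sets_PiM_I_finite)
    also have "\<dots> = (\<integral>\<^sup>+x. (\<Prod>i\<in>I. h i (x i) * indicator (A i) (x i)) \<partial>PiM I M)"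
    proof (rule nn_integral_cong)
      fix x assume "x \<in> space (PiM I M)"
      then have "indicator (Pi\<^sub>E I A) x = (\<Prod>i\<in>I. indicator (A i) (x i) :: ennreal)"
        using I by (auto simp: indicator_def space_PiM PiE_def prod_zero_iff Pi_iff)
      then show "(\<Prod>i\<in>I. h i (x i)) * indicator (Pi\<^sub>E I A) x
          = (\<Prod>i\<in>I. h i (x i) * indicator (A i) (x i))"
        by (simp add: prod.distrib)
    qed
    also have "\<dots> = (\<Prod>i\<in>I. \<integral>\<^sup>+x. h i x * indicator (A i) x \<partial>M i)"
      using I by (intro M.product_nn_integral_prod) auto
    also have "\<dots> = (\<Prod>i\<in>I. emeasure (density (M i) (h i)) (A i))"
      by (intro prod.cong refl) (simp add: emeasure_density)
    finally show "emeasure (density (PiM I M) (\<lambda>x. \<Prod>i\<in>I. h i (x i))) (Pi\<^sub>E I A)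
        = (\<Prod>i\<in>I. emeasure (density (M i) (h i)) (A i))" .
  qed
qed

text \<open>The Hellinger affinity of \<open>P\<close> and \<open>Q\<close>, in the asymmetric form \<open>\<integral> sqrt (dQ/dP) dP\<close>,
  which needs no reference measure and is multiplicative on products.\<close>

definition affinity_ge :: "'a measure \<Rightarrow> 'a measure \<Rightarrow> real \<Rightarrow> bool" where
  "affinity_ge P Q \<rho> \<longleftrightarrow> prob_space P \<and> prob_space Q \<and>
     (\<exists>q. q \<in> borel_measurable P \<and> (\<forall>x. 0 \<le> q x) \<and> Q = density P (\<lambda>x. ennreal (q x)) \<and>
          ennreal \<rho> \<le> (\<integral>\<^sup>+x. ennreal (sqrt (q x)) \<partial>P))"

text \<open>The product law has the product of the densities, and the square root is multiplicative,
  so the integral factorises. Applied below twice: over coordinates and over observations.\<close>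

lemma affinity_ge_PiM:
  assumes I: "finite I" and aff: "affinity_ge P Q \<rho>" and "0 \<le> \<rho>"
  shows "affinity_ge (PiM I (\<lambda>_. P)) (PiM I (\<lambda>_. Q)) (\<rho> ^ card I)"
proof -
  from aff obtain q where P: "prob_space P" and Q: "prob_space Q"
    and q[measurable]: "q \<in> borel_measurable P" and q0: "\<And>x. 0 \<le> q x"
    and density: "Q = density P (\<lambda>x. ennreal (q x))"
    and \<rho>: "ennreal \<rho> \<le> (\<integral>\<^sup>+x. ennreal (sqrt (q x)) \<partial>P)"
    unfolding affinity_ge_def by blast
  interpret P: product_prob_space "\<lambda>_. P"
    using P by (rule product_prob_spaceI)
  let ?q = "\<lambda>x. \<Prod>i\<in>I. q (x i)"
  have "PiM I (\<lambda>_. Q) = density (PiM I (\<lambda>_. P)) (\<lambda>x. \<Prod>i\<in>I. ennreal (q (x i)))"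
    unfolding density by (rule PiM_density[symmetric]) (use I P Q density in auto)
  then have "PiM I (\<lambda>_. Q) = density (PiM I (\<lambda>_. P)) (\<lambda>x. ennreal (?q x))"
    using q0 by (simp add: prod_ennreal)
  moreover have "?q \<in> borel_measurable (PiM I (\<lambda>_. P))"
    by measurable
  moreover have "ennreal (\<rho> ^ card I) \<le> (\<integral>\<^sup>+x. ennreal (sqrt (?q x)) \<partial>PiM I (\<lambda>_. P))"
  proof -
    have "sqrt (?q x) = (\<Prod>i\<in>I. sqrt (q (x i)))" for x
      using I by (induction I) (auto simp: real_sqrt_mult)
    then have "(\<integral>\<^sup>+x. ennreal (sqrt (?q x)) \<partial>PiM I (\<lambda>_. P))
        = (\<integral>\<^sup>+x. (\<Prod>i\<in>I. ennreal (sqrt (q (x i)))) \<partial>PiM I (\<lambda>_. P))"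
      using q0 by (simp add: prod_ennreal)
    also have "\<dots> = (\<Prod>i\<in>I. \<integral>\<^sup>+x. ennreal (sqrt (q x)) \<partial>P)"
      using I by (intro P.product_nn_integral_prod) auto
    also have "\<dots> \<ge> (ennreal \<rho>) ^ card I"
      using \<rho> by (simp add: power_mono)
    finally show ?thesis
      using \<open>0 \<le> \<rho>\<close> by (simp add: ennreal_power)
  qed
  moreover have "\<forall>x. 0 \<le> ?q x"
    using q0 by (simp add: prod_nonneg)
  ultimately show ?thesis
    unfolding affinity_ge_def using P Q by (blast intro: prob_space_PiM)
qed

text \<open>Integrate \<open>\<bar>\<theta>' - \<theta>\<bar> sqrt q \<le> \<bar>T - \<theta>\<bar> sqrt q + \<bar>T - \<theta>'\<bar> sqrt q\<close> with \<open>q = dQ/dP\<close>. Instead of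
  Cauchy--Schwarz, AM-GM with the weight \<open>m\<close> is used, so that no integrability has to be
  discussed.\<close>

lemma two_point_lower_bound:
  fixes T :: "'a \<Rightarrow> real"
  assumes aff: "affinity_ge P Q \<rho>" and T[measurable]: "T \<in> borel_measurable P"
    and "0 \<le> \<rho>" "0 < m"
    and risk_P: "(\<integral>\<^sup>+x. ennreal ((T x - \<theta>)\<^sup>2) \<partial>P) \<le> ennreal (m\<^sup>2)"
    and risk_Q: "(\<integral>\<^sup>+x. ennreal ((T x - \<theta>')\<^sup>2) \<partial>Q) \<le> ennreal (m\<^sup>2)"
  shows "\<bar>\<theta>' - \<theta>\<bar> * \<rho> \<le> 2 * m"
proof -
  from aff obtain q where P: "prob_space P" and Q: "prob_space Q"
    and q[measurable]: "q \<in> borel_measurable P" and q0: "\<And>x. 0 \<le> q x"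
    and density: "Q = density P (\<lambda>x. ennreal (q x))"
    and \<rho>: "ennreal \<rho> \<le> (\<integral>\<^sup>+x. ennreal (sqrt (q x)) \<partial>P)"
    unfolding affinity_ge_def by blast
  interpret P: prob_space P by fact
  interpret Q: prob_space Q by fact
  have int_q: "(\<integral>\<^sup>+x. ennreal (q x) \<partial>P) = 1"
    using Q.emeasure_space_1 by (simp add: density emeasure_density cong: nn_integral_cong)
  have risk_Q': "(\<integral>\<^sup>+x. ennreal (q x * (T x - \<theta>')\<^sup>2) \<partial>P) \<le> ennreal (m\<^sup>2)"
    using risk_Q q0 unfolding density by (simp add: nn_integral_density ennreal_mult)
  have pointwise: "2 * m * \<bar>\<theta>' - \<theta>\<bar> * sqrt (q x)
      \<le> (T x - \<theta>)\<^sup>2 + m\<^sup>2 * q x + q x * (T x - \<theta>')\<^sup>2 + m\<^sup>2" for x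
  proof -
    have "0 \<le> (\<bar>T x - \<theta>\<bar> - m * sqrt (q x))\<^sup>2" "0 \<le> (sqrt (q x) * \<bar>T x - \<theta>'\<bar> - m)\<^sup>2"
      by simp_all
    then have "2 * m * sqrt (q x) * (\<bar>T x - \<theta>\<bar> + \<bar>T x - \<theta>'\<bar>)
        \<le> (T x - \<theta>)\<^sup>2 + m\<^sup>2 * q x + q x * (T x - \<theta>')\<^sup>2 + m\<^sup>2"
      using q0[of x] by (simp add: power2_diff power_mult_distrib algebra_simps)
    moreover have "2 * m * sqrt (q x) * \<bar>\<theta>' - \<theta>\<bar>
        \<le> 2 * m * sqrt (q x) * (\<bar>T x - \<theta>\<bar> + \<bar>T x - \<theta>'\<bar>)"
      using \<open>0 < m\<close> q0[of x] by (intro mult_left_mono) auto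
    ultimately show ?thesis
      by (simp add: mult_ac)
  qed
  have "ennreal (2 * m * \<bar>\<theta>' - \<theta>\<bar> * \<rho>) = ennreal (2 * m * \<bar>\<theta>' - \<theta>\<bar>) * ennreal \<rho>"
    using \<open>0 < m\<close> \<open>0 \<le> \<rho>\<close> by (simp add: ennreal_mult)
  also have "\<dots> \<le> ennreal (2 * m * \<bar>\<theta>' - \<theta>\<bar>) * (\<integral>\<^sup>+x. ennreal (sqrt (q x)) \<partial>P)"
    using \<rho> by (rule mult_left_mono) simp
  also have "\<dots> = (\<integral>\<^sup>+x. ennreal (2 * m * \<bar>\<theta>' - \<theta>\<bar> * sqrt (q x)) \<partial>P)"
    using \<open>0 < m\<close> q0 by (simp add: ennreal_mult nn_integral_cmult)
  also have "\<dots> \<le> (\<integral>\<^sup>+x. ennreal ((T x - \<theta>)\<^sup>2 + m\<^sup>2 * q x + q x * (T x - \<theta>')\<^sup>2 + m\<^sup>2) \<partial>P)"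
    using pointwise by (intro nn_integral_mono ennreal_leI)
  also have "\<dots> = (\<integral>\<^sup>+x. ennreal ((T x - \<theta>)\<^sup>2) + ennreal (m\<^sup>2) * ennreal (q x)
      + ennreal (q x * (T x - \<theta>')\<^sup>2) + ennreal (m\<^sup>2) \<partial>P)"
    using q0 by (intro nn_integral_cong) (simp add: ennreal_mult)
  \<comment> \<open>Each of the four terms is at most \<open>m\<^sup>2\<close>: two are the risks,
    one uses that \<open>q\<close> integrates to 1, one that \<open>P\<close> is a probability
    measure.\<close>
  also have "\<dots> = (\<integral>\<^sup>+x. ennreal ((T x - \<theta>)\<^sup>2) \<partial>P) + ennreal (m\<^sup>2)
      + (\<integral>\<^sup>+x. ennreal (q x * (T x - \<theta>')\<^sup>2) \<partial>P) + ennreal (m\<^sup>2)"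
    by (simp add: nn_integral_add nn_integral_cmult int_q P.emeasure_space_1)
  also have "\<dots> \<le> ennreal (m\<^sup>2) + ennreal (m\<^sup>2) + ennreal (m\<^sup>2) + ennreal (m\<^sup>2)"
    by (intro add_mono risk_P risk_Q' order_refl)
  also have "\<dots> = ennreal (4 * m\<^sup>2)"
    by (simp flip: ennreal_plus)
  finally have "2 * m * (\<bar>\<theta>' - \<theta>\<bar> * \<rho>) \<le> 2 * m * (2 * m)"
    by (simp add: ennreal_le_iff power2_eq_square mult_ac)
  then show ?thesis
    using \<open>0 < m\<close> by (simp add: mult.commute)
qed

section \<open>Affinity of two centered normal laws\<close>

lemma prob_space_centered_normal:
  assumes "s > 0"
  shows "prob_space (centered_normal s)"
  using assms by (simp add: centered_normal_def prob_space_normal_density)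

lemma affinity_normal:
  assumes "0 < s" "0 < s'"
  shows "affinity_ge (centered_normal s) (centered_normal s') (sqrt (2 * sqrt (s * s') / (s + s')))"
proof -
  let ?p = "normal_density 0 (sqrt s)" and ?p' = "normal_density 0 (sqrt s')"
  let ?q = "\<lambda>x. ?p' x / ?p x"
  \<comment> \<open>The normalised geometric mean of the two densities is the normal density whose variance
    \<open>v\<close> is the harmonic mean of the two variances.\<close>
  define v where "v = 2 * s * s' / (s + s')"
  define \<rho> where "\<rho> = sqrt (2 * sqrt (s * s') / (s + s'))"
  have p: "0 < ?p x" "0 < ?p' x" for x
    using assms by (simp_all add: normal_density_pos)
  have v: "v > 0"
    using assms by (simp add: v_def)
  have normal: "centered_normal s = density lborel (\<lambda>x. ennreal (?p x))"
    "centered_normal s' = density lborel (\<lambda>x. ennreal (?p' x))"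
    using assms by (simp_all add: centered_normal_def)
  interpret N: prob_space "density lborel (\<lambda>x. ennreal (normal_density 0 (sqrt v) x))"
    using v by (intro prob_space_normal_density) simp
  have density: "centered_normal s' = density (centered_normal s) (\<lambda>x. ennreal (?q x))"
  proof -
    have "ennreal (?p x) * ennreal (?q x) = ennreal (?p' x)" for x
      using p(1)[of x] by (simp add: flip: ennreal_mult)
    then show ?thesis
      unfolding normal by (subst density_density_eq) simp_all
  qed
  have "sqrt (?p x * ?p' x) = \<rho> * normal_density 0 (sqrt v) x" for x
  proof (rule power2_eq_imp_eq)
    have "(sqrt (?p x * ?p' x))\<^sup>2 = ?p x * ?p' x"
      using p by (simp add: less_imp_le)
    also have "\<dots> = (1 / (2 * pi * sqrt (s * s'))) * exp (- x\<^sup>2 / (2 * s) + - x\<^sup>2 / (2 * s'))"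
    proof -
      have "sqrt (2 * pi * s) * sqrt (2 * pi * s') = sqrt ((2 * pi)\<^sup>2 * (s * s'))"
        by (simp add: power2_eq_square mult_ac flip: real_sqrt_mult)
      also have "\<dots> = 2 * pi * sqrt (s * s')"
        by (simp only: real_sqrt_mult real_sqrt_abs) simp
      finally have "2 * pi * sqrt (s * s') = sqrt (2 * pi * s) * sqrt (2 * pi * s')" ..
      then show ?thesis
        unfolding exp_add normal_density_def using assms by simp
    qed
    also have "- x\<^sup>2 / (2 * s) + - x\<^sup>2 / (2 * s') = 2 * (- x\<^sup>2 / (2 * v))"
      using assms by (simp add: v_def field_simps)
    also have "1 / (2 * pi * sqrt (s * s')) = \<rho>\<^sup>2 * (1 / (2 * pi * v))"
    proof -
      \<comment> \<open>The sum \<open>u\<close> cancels in \<open>\<rho>\<^sup>2 / v\<close>,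
        leaving \<open>1 / w\<close>.\<close>
      define u w where "u = s + s'" and "w = sqrt (s * s')"
      have pos: "0 < u" "0 < w"
        using assms by (simp_all add: u_def w_def)
      have \<rho>_eq: "\<rho>\<^sup>2 = 2 * w / u"
        using assms by (simp add: \<rho>_def u_def w_def)
      have v_eq: "v = 2 * (w * w) / u"
        using assms by (simp add: v_def u_def w_def)
      show ?thesis
        unfolding \<rho>_eq v_eq w_def[symmetric] using pos by (simp add: field_simps)
    qed
    also have "\<rho>\<^sup>2 * (1 / (2 * pi * v)) * exp (2 * (- x\<^sup>2 / (2 * v)))
        = (\<rho> * normal_density 0 (sqrt v) x)\<^sup>2"
      unfolding exp_double using v by (simp add: normal_density_def power_mult_distrib power_divide)
    finally show "(sqrt (?p x * ?p' x))\<^sup>2 = (\<rho> * normal_density 0 (sqrt v) x)\<^sup>2" .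
  qed (use p assms in \<open>auto simp: \<rho>_def less_imp_le\<close>)
  moreover have "?p x * sqrt (?q x) = sqrt (?p x * ?p' x)" for x
  proof -
    have "?p x * ?p' x = (?p x)\<^sup>2 * ?q x"
      using p(1)[of x] by (simp add: power2_eq_square)
    then show ?thesis
      using p(1)[of x] by (simp only: real_sqrt_mult[of "(?p x)\<^sup>2"] real_sqrt_abs abs_of_pos)
  qed
  ultimately have eq: "?p x * sqrt (?q x) = \<rho> * normal_density 0 (sqrt v) x" for x
    by simp
  have "(\<integral>\<^sup>+x. ennreal (sqrt (?q x)) \<partial>centered_normal s)
      = (\<integral>\<^sup>+x. ennreal (\<rho> * normal_density 0 (sqrt v) x) \<partial>lborel)"
    unfolding normal using p
    by (simp add: nn_integral_density less_imp_le eq flip: ennreal_mult)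
  also have "\<dots> = ennreal \<rho>"
    using N.emeasure_space_1 assms
    by (simp add: \<rho>_def ennreal_mult nn_integral_cmult emeasure_density)
  finally show ?thesis
    unfolding affinity_ge_def \<rho>_def[symmetric]
    by (intro conjI exI[of _ ?q] density prob_space_centered_normal assms) (simp_all add: normal)
qed

section \<open>Gaussian measures on finite-dimensional subspaces\<close>

lemma sets_centered_normal[measurable_cong]: "sets (centered_normal v) = sets borel"
  by (simp add: centered_normal_def)

definition gaussian_sum :: "'a::real_inner set \<Rightarrow> ('a \<Rightarrow> real) \<Rightarrow> 'a" where
  "gaussian_sum C g = (\<Sum>c\<in>C. g c *\<^sub>R c)"

text \<open>This concrete law is the witness for the supremum over Gaussian measures in
  \<open>minimax_rmse\<close>; as the image of a product it lets risks be computed in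
  coordinates.\<close>

definition gaussian_on :: "'a::real_inner set \<Rightarrow> real \<Rightarrow> 'a measure" where
  "gaussian_on C s = distr (PiM C (\<lambda>_. centered_normal s)) borel (gaussian_sum C)"

lemma measurable_gaussian_sum[measurable]:
  fixes C :: "'a::{real_inner, second_countable_topology} set"
  shows "gaussian_sum C \<in> borel_measurable (PiM C (\<lambda>_. centered_normal s))"
  unfolding gaussian_sum_def[abs_def] by measurable

text \<open>Projecting on \<open>u\<close> gives a linear combination of independent normals with
  coefficients \<open>c \<bullet> u\<close>, whose variance is \<open>s\<close> times the sum of the
  squared coefficients.\<close>

lemma centered_gaussian_gaussian_on:
  fixes C :: "'a::{real_inner, second_countable_topology} set"
  assumes C: "finite C" and "s > 0"
  shows "centered_gaussian (gaussian_on C s) (\<lambda>x. s *\<^sub>R orth_proj C x)"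
proof -
  let ?N = "PiM C (\<lambda>_. centered_normal s)"
  interpret N: product_prob_space "\<lambda>_. centered_normal s" C
    using prob_space_centered_normal[OF \<open>s > 0\<close>] by (rule product_prob_spaceI)
  interpret N: prob_space ?N
    by (intro prob_space_PiM prob_space_centered_normal \<open>s > 0\<close>)
  have coord: "distr ?N borel (\<lambda>g. g c) = centered_normal s" if "c \<in> C" for c
  proof -
    have "distr ?N borel (\<lambda>g. g c) = distr ?N (centered_normal s) (\<lambda>g. g c)"
      by (intro distr_cong) (simp_all add: sets_centered_normal)
    also have "\<dots> = centered_normal s"
      using distr_PiM_component[OF prob_space_centered_normal[OF \<open>s > 0\<close>] that] .
    finally show ?thesis .
  qed
  \<comment> \<open>The joint law of the coordinates is the product measure they live on. This
    characterisation of independence requires a nonempty index set.\<close>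
  have indep: "N.indep_vars (\<lambda>_. borel) (\<lambda>c g. g c) C" if "C \<noteq> {}"
  proof (subst N.indep_vars_iff_distr_eq_PiM'[OF that])
    show "(\<lambda>g. g c) \<in> borel_measurable ?N" if "c \<in> C" for c
      using that by measurable
    have "distr ?N (PiM C (\<lambda>_. borel)) (\<lambda>g. \<lambda>c\<in>C. g c) = distr ?N ?N (\<lambda>g. g)"
      by (intro distr_cong sets_PiM_cong)
        (auto simp: sets_centered_normal space_PiM PiE_def extensional_restrict)
    also have "\<dots> = PiM C (\<lambda>c. distr ?N borel (\<lambda>g. g c))"
      using coord by (auto simp: distr_id intro: PiM_cong)
    finally show "distr ?N (PiM C (\<lambda>_. borel)) (\<lambda>g. \<lambda>c\<in>C. g c)
        = PiM C (\<lambda>c. distr ?N borel (\<lambda>g. g c))" .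
  qed
  have "distr ?N borel (\<lambda>g. gaussian_sum C g \<bullet> u) = centered_normal ((s *\<^sub>R orth_proj C u) \<bullet> u)" for u
  proof -
    \<comment> \<open>Coordinates orthogonal to \<open>u\<close> contribute the constant 0, which
      has no density, so they are dropped. If none remain, the law is the point mass that
      \<open>centered_normal\<close> assigns to variance 0.\<close>
    define I where "I = {c \<in> C. c \<bullet> u \<noteq> 0}"
    have I: "finite I" "I \<subseteq> C"
      using C by (auto simp: I_def)
    have var: "(s *\<^sub>R orth_proj C u) \<bullet> u = (\<Sum>c\<in>I. (\<bar>c \<bullet> u\<bar> * sqrt s)\<^sup>2)"
    proof -
      have "(s *\<^sub>R orth_proj C u) \<bullet> u = (\<Sum>c\<in>C. (\<bar>c \<bullet> u\<bar> * sqrt s)\<^sup>2)"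
        unfolding inner_scaleR_left inner_orth_proj_self sum_distrib_left
        using \<open>s > 0\<close> by (simp add: power_mult_distrib inner_commute mult.commute)
      also have "\<dots> = (\<Sum>c\<in>I. (\<bar>c \<bullet> u\<bar> * sqrt s)\<^sup>2)"
        using C by (intro sum.mono_neutral_right) (auto simp: I_def)
      finally show ?thesis .
    qed
    \<comment> \<open>The \<open>0 +\<close> brings each summand into the affine form of
      \<open>normal_density_affine\<close>.\<close>
    have proj: "gaussian_sum C g \<bullet> u = (\<Sum>c\<in>I. 0 + (c \<bullet> u) * g c)" for g
      unfolding gaussian_sum_def inner_sum_left
      using C by (intro sum.mono_neutral_cong_right) (auto simp: I_def)
    show ?thesis
    proof (cases "I = {}")
      case True
      have "distr ?N borel (\<lambda>g. 0::real) = return borel 0"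
        by (intro N.distr_const) simp
      then show ?thesis
        unfolding var proj using True by (simp add: centered_normal_def)
    next
      case False
      have "C \<noteq> {}"
        using False I by auto
      have "N.indep_vars (\<lambda>_. borel) (\<lambda>c g. 0 + (c \<bullet> u) * g c) I"
        using N.indep_vars_subset[OF indep[OF \<open>C \<noteq> {}\<close>] I(2)]
        by (rule N.indep_vars_compose2) simp
      moreover have "distributed ?N lborel (\<lambda>g. 0 + (c \<bullet> u) * g c)
          (normal_density (0 + (c \<bullet> u) * 0) (\<bar>c \<bullet> u\<bar> * sqrt s))" if "c \<in> I" for c
      proof (rule N.normal_density_affine)
        have c: "c \<in> C" "c \<bullet> u \<noteq> 0"
          using that by (auto simp: I_def)
        then show "c \<bullet> u \<noteq> 0" "0 < sqrt s"
          using \<open>s > 0\<close> by simp_all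
        have "distr ?N lborel (\<lambda>g. g c) = distr ?N borel (\<lambda>g. g c)"
          by (intro distr_cong) simp_all
        then show "distributed ?N lborel (\<lambda>g. g c) (normal_density 0 (sqrt s))"
          unfolding distributed_def using coord[OF c(1)] c(1) \<open>s > 0\<close>
          by (simp add: centered_normal_def)
      qed
      ultimately have "distributed ?N lborel (\<lambda>g. \<Sum>c\<in>I. 0 + (c \<bullet> u) * g c)
          (normal_density (\<Sum>c\<in>I. 0 + (c \<bullet> u) * 0) (sqrt (\<Sum>c\<in>I. (\<bar>c \<bullet> u\<bar> * sqrt s)\<^sup>2)))"
        using False I \<open>s > 0\<close> by (intro N.sum_indep_normal) (auto simp: I_def)
      then have "distr ?N lborel (\<lambda>g. \<Sum>c\<in>I. 0 + (c \<bullet> u) * g c)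
          = density lborel (\<lambda>x. ennreal (normal_density 0 (sqrt (\<Sum>c\<in>I. (\<bar>c \<bullet> u\<bar> * sqrt s)\<^sup>2)) x))"
        by (simp add: distributed_def)
      moreover have "(\<Sum>c\<in>I. (\<bar>c \<bullet> u\<bar> * sqrt s)\<^sup>2) > 0"
        using False I \<open>s > 0\<close> by (intro sum_pos) (auto simp: I_def)
      moreover have "distr ?N borel (\<lambda>g. \<Sum>c\<in>I. 0 + (c \<bullet> u) * g c)
          = distr ?N lborel (\<lambda>g. \<Sum>c\<in>I. 0 + (c \<bullet> u) * g c)"
        by (intro distr_cong) simp_all
      ultimately show ?thesis
        unfolding var proj centered_normal_def by simp
    qed
  qed
  then show ?thesis
    unfolding centered_gaussian_def gaussian_on_def
    by (auto simp: distr_distr comp_def intro: N.prob_space_distr)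
qed

text \<open>A product of image measures is the image of the product, so the risk becomes that of an
  estimator in the normal coefficients. There the affinity of products of real normal laws
  applies.\<close>

lemma risk_gaussian_on:
  fixes C :: "'a::{real_inner, second_countable_topology} set"
  assumes "finite C" "s > 0" and T: "T \<in> estimators n"
  shows "(\<integral>\<^sup>+X. ennreal ((T X - \<theta>)\<^sup>2) \<partial>PiM {..<n} (\<lambda>_. gaussian_on C s))
    = (\<integral>\<^sup>+G. ennreal ((T (compose {..<n} (gaussian_sum C) G) - \<theta>)\<^sup>2)
        \<partial>PiM {..<n} (\<lambda>_. PiM C (\<lambda>_. centered_normal s)))" (is "?L = ?R")
    and "(\<lambda>G. T (compose {..<n} (gaussian_sum C) G))
      \<in> borel_measurable (PiM {..<n} (\<lambda>_. PiM C (\<lambda>_. centered_normal s)))" (is ?M)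
proof -
  let ?N = "PiM C (\<lambda>_. centered_normal s)" and ?G = "gaussian_on C s"
  have N: "prob_space ?N"
    by (intro prob_space_PiM prob_space_centered_normal assms(2))
  have G: "prob_space ?G" and sets_G[measurable_cong]: "sets ?G = sets borel"
    using centered_gaussian_gaussian_on[OF assms(1,2)] unfolding centered_gaussian_def by auto
  have T'[measurable]: "T \<in> borel_measurable (PiM {..<n} (\<lambda>_. borel))"
    using T by (simp add: estimators_def)
  have meas[measurable]: "compose {..<n} (gaussian_sum C)
      \<in> measurable (PiM {..<n} (\<lambda>_. ?N)) (PiM {..<n} (\<lambda>_. ?G))"
    unfolding compose_def[abs_def] by measurable
  have "?G = distr ?N ?G (gaussian_sum C)"
    unfolding gaussian_on_def by (intro distr_cong) simp_all
  then have "PiM {..<n} (\<lambda>_. ?G) = PiM {..<n} (\<lambda>_. distr ?N ?G (gaussian_sum C))"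
    by simp
  also have "\<dots> = distr (PiM {..<n} (\<lambda>_. ?N)) (PiM {..<n} (\<lambda>_. ?G)) (compose {..<n} (gaussian_sum C))"
    by (intro distr_PiM_finite_prob_space'[symmetric] N G) simp_all
  finally have eq: "PiM {..<n} (\<lambda>_. ?G)
      = distr (PiM {..<n} (\<lambda>_. ?N)) (PiM {..<n} (\<lambda>_. ?G)) (compose {..<n} (gaussian_sum C))" .
  show "?L = ?R"
    by (subst eq, subst nn_integral_distr) simp_all
  have "compose {..<n} (gaussian_sum C) \<in> measurable (PiM {..<n} (\<lambda>_. ?N)) (PiM {..<n} (\<lambda>_. borel))"
    unfolding compose_def[abs_def] by measurable
  then show ?M
    using T' by (rule measurable_compose)
qed

section \<open>The minimax bound\<close>

lemma ennsqrt_le_imp_le_square: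
  assumes "ennsqrt x \<le> ennreal m" "0 \<le> m"
  shows "x \<le> ennreal (m\<^sup>2)"
proof (cases x)
  case (real y)
  then have "sqrt y \<le> m"
    using assms by (simp add: ennsqrt_def)
  then have "y \<le> m\<^sup>2"
    by (rule sqrt_le_D)
  then show ?thesis
    using real by (simp add: ennreal_leI)
qed (use assms in \<open>simp add: ennsqrt_def top_unique\<close>)

text \<open>For variances in the ratio \<open>1 - t\<close> the fourth power of the affinity is
  \<open>4 (1 - t) / (2 - t)\<^sup>2 = 1 - (t / (2 - t))\<^sup>2\<close>, to which Bernoulli's inequality applies.\<close>

lemma normal_affinity_power_ge:
  assumes "s > 0" "0 \<le> t" "t \<le> 1/2" "real N * t\<^sup>2 \<le> 1/4"
  shows "3/4 \<le> sqrt (2 * sqrt (s * (s * (1 - t))) / (s + s * (1 - t))) ^ N" (is "_ \<le> ?\<rho> ^ N")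
proof -
  have t2: "t\<^sup>2 \<le> 1"
    using assms(2,3) by (simp add: power_le_one)
  have "?\<rho> = sqrt (2 * sqrt (1 - t) / (2 - t))"
  proof -
    have "2 * sqrt (s * (s * (1 - t))) / (s + s * (1 - t)) = s * (2 * sqrt (1 - t)) / (s * (2 - t))"
    proof -
      have "sqrt (s * (s * (1 - t))) = s * sqrt (1 - t)"
        using assms(1) by (simp add: real_sqrt_mult flip: mult.assoc)
      moreover have "s + s * (1 - t) = s * (2 - t)"
        by (simp add: algebra_simps)
      ultimately show ?thesis
        by simp
    qed
    then show ?thesis
      using assms(1) by simp
  qed
  then have "(?\<rho>\<^sup>2)\<^sup>2 = 4 * (1 - t) / (2 - t)\<^sup>2"
    using assms by (simp add: power_divide power_mult_distrib)
  \<comment> \<open>As \<open>2 - t \<ge> 1\<close>, the square \<open>(t / (2 - t))\<^sup>2\<close>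
    is at most \<open>t\<^sup>2\<close>; the identity below expresses this after clearing the
    denominator.\<close>
  also have "\<dots> \<ge> 1 - t\<^sup>2"
  proof -
    have "4 * (1 - t) - (1 - t\<^sup>2) * (2 - t)\<^sup>2 = t\<^sup>2 * ((2 - t)\<^sup>2 - 1)"
      by (simp add: power2_eq_square algebra_simps)
    moreover have "1 \<le> (2 - t)\<^sup>2"
      using assms(3) by (simp add: one_le_power)
    ultimately have "(1 - t\<^sup>2) * (2 - t)\<^sup>2 \<le> 4 * (1 - t)"
      by (smt (verit) mult_nonneg_nonneg zero_le_power2)
    then show ?thesis
      using assms(3) by (simp add: pos_le_divide_eq)
  qed
  finally have "1 - t\<^sup>2 \<le> ?\<rho> ^ 4"
    by (simp flip: power_mult)
  then have "(1 - t\<^sup>2) ^ N \<le> (?\<rho> ^ 4) ^ N"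
    using t2 by (intro power_mono) simp_all
  moreover have "1 - real N * t\<^sup>2 \<le> (1 - t\<^sup>2) ^ N"
    using Bernoulli_inequality[of "- t\<^sup>2" N] t2 by simp
  \<comment> \<open>Bernoulli leaves at least \<open>3/4\<close>, which exceeds
    \<open>(3/4) ^ 4\<close>; then the fourth root is taken.\<close>
  ultimately have "(3/4) ^ 4 \<le> (?\<rho> ^ N) ^ 4"
    using assms(4) by (simp add: power_commutes flip: power_mult) (simp add: power_divide mult.commute)
  then show ?thesis
    using assms by (intro power_mono_iff[THEN iffD1, of "3/4" "?\<rho> ^ N" 4]) auto
qed

text \<open>If some \<open>T\<close> had risk at most \<open>b\<close> at both variances
  \<open>s\<close> and \<open>s * (1 - t)\<close>, then \<open>two_point_lower_bound\<close> with
  affinity at least \<open>3/4\<close> would contradict the upper bound on \<open>b\<close>.\<close>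

lemma minimax_rmse_ge:
  fixes C :: "'a::{real_inner, complete_space, second_countable_topology} set"
  assumes C: "finite C" "orthonormal C" "C \<noteq> {}" and H: "subspace H" "C \<subseteq> H"
    and "real (card C) \<le> r" and s: "0 < s" "s \<le> a"
    and t: "0 \<le> t" "t \<le> 1/2" "real (card C * n) * t\<^sup>2 \<le> 1/4"
    and b: "0 < b" "2 * b < 3/4 * (real (card C) * \<bar>f s - f (s * (1 - t))\<bar>)"
  shows "ennreal b \<le> minimax_rmse H a r n f"
  unfolding minimax_rmse_def
proof (rule INF_greatest)
  fix T :: "(nat \<Rightarrow> 'a) \<Rightarrow> real" assume T: "T \<in> estimators n"
  let ?risk = "\<lambda>S M. rmse n M T (trace_functional f S)"
  let ?sup = "SUP S\<in>cov_class H a r. SUP M\<in>{M. centered_gaussian M S}. ?risk S M"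
  let ?S = "\<lambda>v x. v *\<^sub>R orth_proj C x"
  show "ennreal b \<le> ?sup"
  proof (rule ccontr)
    assume "\<not> ennreal b \<le> ?sup"
    then have sup: "?sup \<le> ennreal b"
      by simp
    let ?P = "\<lambda>v. PiM {..<n} (\<lambda>_. PiM C (\<lambda>_. centered_normal v))"
    let ?T = "\<lambda>G. T (compose {..<n} (gaussian_sum C) G)"
    have risk: "(\<integral>\<^sup>+G. ennreal ((?T G - real (card C) * f v)\<^sup>2) \<partial>?P v) \<le> ennreal (b\<^sup>2)"
      if v: "0 < v" "v \<le> a" for v
    proof -
      have "?risk (?S v) (gaussian_on C v) \<le> ?sup"
        by (rule SUP_upper2[OF orth_proj_in_cov_class[OF C H v \<open>real (card C) \<le> r\<close>]], rule SUP_upper)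
          (simp add: centered_gaussian_gaussian_on C v)
      then have "?risk (?S v) (gaussian_on C v) \<le> ennreal b"
        using sup by (rule order_trans)
      then show ?thesis
        using b(1) unfolding rmse_def trace_functional_orth_proj[OF C v(1)] risk_gaussian_on(1)[OF C(1) v(1) T]
        by (intro ennsqrt_le_imp_le_square) simp_all
    qed
    define s' where "s' = s * (1 - t)"
    have s': "0 < s'" "s' \<le> a"
      using s t mult_left_le[of "1 - t" s] unfolding s'_def by (simp_all, linarith)
    define \<rho> where "\<rho> = sqrt (2 * sqrt (s * s') / (s + s'))"
    have "0 \<le> \<rho>"
      using s s' by (simp add: \<rho>_def)
    \<comment> \<open>The inner product over \<open>C\<close> and the outer one over the
      observations each raise the affinity to a power, so the exponents multiply.\<close>
    have "affinity_ge (?P s) (?P s') ((\<rho> ^ card C) ^ card {..<n})"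
      unfolding \<rho>_def using C(1) s s'
      by (intro affinity_ge_PiM affinity_normal) auto
    then have aff: "affinity_ge (?P s) (?P s') (\<rho> ^ (card C * n))"
      by (simp add: power_mult)
    have "\<bar>real (card C) * f s' - real (card C) * f s\<bar> * \<rho> ^ (card C * n) \<le> 2 * b"
      using \<open>0 \<le> \<rho>\<close> b(1) s s'
      by (intro two_point_lower_bound[OF aff risk_gaussian_on(2)[OF C(1) s(1) T]] risk) auto
    moreover have "\<bar>real (card C) * f s' - real (card C) * f s\<bar> = real (card C) * \<bar>f s - f s'\<bar>"
      by (simp add: abs_mult abs_minus_commute flip: right_diff_distrib)
    moreover have "3/4 \<le> \<rho> ^ (card C * n)"
      unfolding \<rho>_def s'_def using s(1) t by (intro normal_affinity_power_ge)
    then have "real (card C) * \<bar>f s - f s'\<bar> * (3/4) \<le> real (card C) * \<bar>f s - f s'\<bar> * \<rho> ^ (card C * n)"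
      by (intro mult_left_mono) simp_all
    ultimately show False
      using b(2) by (simp add: s'_def)
  qed
qed

theorem proposition2p3:
  fixes \<gamma>1 \<gamma>2 lam :: real
  assumes "0 \<le> \<gamma>1" and "\<gamma>1 < \<gamma>2" and "\<gamma>2 \<le> 1" and "lam > 0"
  shows "\<exists>\<kappa>>0. \<forall>(H :: 'a::{real_inner, complete_space, second_countable_topology} set)
           (a :: real) (r :: real) (n :: nat) (f :: real \<Rightarrow> real) (f' :: real \<Rightarrow> real).
           subspace H \<longrightarrow> closed H \<longrightarrow>
           a > 0 \<longrightarrow> r \<ge> 1 \<longrightarrow> n \<ge> 1 \<longrightarrow>
           (\<exists>B\<subseteq>H. finite B \<and> independent B \<and> r \<le> real (card B)) \<longrightarrow>
           (\<forall>x\<in>{0..}. (f has_real_derivative f' x) (at x within {0..})) \<longrightarrow>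
           continuous_on {0..} f' \<longrightarrow>
           f 0 = 0 \<longrightarrow>
           (\<forall>x\<in>{\<gamma>1 * a..\<gamma>2 * a}. \<bar>f' x\<bar> \<ge> lam) \<longrightarrow>
           minimax_rmse H a r n f \<ge> ennreal (\<kappa> * a * sqrt (r / real n))"
proof -
  \<comment> \<open>The entry \<open>1/2\<close> gives \<open>t \<le> 1/2\<close> and bounds
    \<open>d n t\<^sup>2 = \<delta>\<^sup>2\<close> by \<open>1/4\<close>; the other keeps
    \<open>s (1 - t)\<close> at or above \<open>\<gamma>1 a\<close>.\<close>
  define \<delta> where "\<delta> = min (1/2) ((\<gamma>2 - \<gamma>1) / \<gamma>2)"
  have "\<gamma>2 > 0"
    using assms by simp
  have \<delta>: "0 < \<delta>" "\<delta> \<le> 1/2" "\<gamma>2 * \<delta> \<le> \<gamma>2 - \<gamma>1"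
    using assms \<open>\<gamma>2 > 0\<close> by (auto simp: \<delta>_def min_def field_simps)
  \<comment> \<open>Fixed before \<open>H\<close>, \<open>a\<close>, \<open>r\<close>,
    \<open>n\<close> and \<open>f\<close>, hence independent of them. The \<open>8\<close> covers
    the 2 of the two-point bound and the 2 of \<open>sqrt (r / n) \<le> 2 q\<close>, and leaves
    \<open>1/2 < 3/4\<close> for the strict inequality.\<close>
  define \<kappa> where "\<kappa> = lam * \<gamma>2 * \<delta> / 8"
  have "\<kappa> > 0"
    using assms \<open>\<gamma>2 > 0\<close> \<delta> by (simp add: \<kappa>_def)
  moreover have "ennreal (\<kappa> * a * sqrt (r / real n)) \<le> minimax_rmse H a r n f"
    if H: "subspace H" and "a > 0" "r \<ge> 1" "n \<ge> 1"
      and B: "B \<subseteq> H" "finite B" "independent B" "r \<le> real (card B)"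
      and f: "\<forall>x\<in>{0..}. (f has_real_derivative f' x) (at x within {0..})"
      and f': "\<forall>x\<in>{\<gamma>1 * a..\<gamma>2 * a}. \<bar>f' x\<bar> \<ge> lam"
    for H B :: "'a set" and a r :: real and n :: nat and f f' :: "real \<Rightarrow> real"
  proof -
    \<comment> \<open>Since \<open>r \<ge> 1\<close>, rounding down costs at most a factor 2:
      \<open>r < d + 1 \<le> 2 d\<close>.\<close>
    define d where "d = nat \<lfloor>r\<rfloor>"
    have d: "1 \<le> d" "real d \<le> r" "r \<le> 2 * real d"
    proof -
      show "1 \<le> d" "real d \<le> r"
        using \<open>r \<ge> 1\<close> by (auto simp: d_def le_nat_floor)
      have "r < real_of_int \<lfloor>r\<rfloor> + 1" "real d = real_of_int \<lfloor>r\<rfloor>"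
        using \<open>r \<ge> 1\<close> by (auto simp: d_def)
      then show "r \<le> 2 * real d"
        using \<open>1 \<le> d\<close> by linarith
    qed
    have "d \<le> card B"
      using d(2) B(4) by linarith
    then obtain C where C: "finite C" "orthonormal C" "card C = d" "C \<subseteq> span B"
      using orthonormal_in_span[OF B(2,3)] by metis
    have CH: "C \<noteq> {}" "C \<subseteq> H"
      using C d(1) span_minimal[OF B(1) H] by auto
    define s where "s = \<gamma>2 * a"
    \<comment> \<open>The scale at which \<open>d n\<close> normal observations stop separating the
      variances: it makes \<open>d n t\<^sup>2\<close> equal to
      \<open>\<delta>\<^sup>2\<close>.\<close>
    define t where "t = \<delta> / sqrt (real (d * n))"
    have dn: "1 \<le> real (d * n)"
      using d(1) \<open>n \<ge> 1\<close> by (metis mult_le_mono nat_mult_1 of_nat_1 of_nat_le_iff)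
    have s: "0 < s" "s \<le> a"
      using \<open>\<gamma>2 > 0\<close> \<open>a > 0\<close> assms(3) by (auto simp: s_def mult_left_le_one_le)
    have t0: "0 < t"
      using \<delta>(1) dn by (simp add: t_def)
    have "t \<le> \<delta>"
      unfolding t_def using \<delta>(1) dn by (simp add: divide_le_eq real_le_rsqrt mult_le_cancel_left1)
    have dnt: "real (d * n) * t\<^sup>2 \<le> 1/4"
    proof -
      have "real (d * n) * t\<^sup>2 = \<delta>\<^sup>2"
        using dn by (simp add: t_def power_divide del: of_nat_mult)
      also have "\<dots> \<le> (1/2)\<^sup>2"
        using \<delta> by (intro power_mono) auto
      finally show ?thesis
        by (simp add: power_divide)
    qed
    have less: "s * (1 - t) < s"
      using s t0 by simp
    have pos: "0 < s * (1 - t)"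
      using s \<open>t \<le> \<delta>\<close> \<delta> by simp
    \<comment> \<open>Positive points are interior to the half-line, so the derivative there is
      two-sided, as the mean value theorem requires.\<close>
    have deriv: "(f has_real_derivative f' x) (at x)" if "0 < x" for x
    proof -
      have "(f has_real_derivative f' x) (at x within {0<..})"
        by (rule has_field_derivative_subset[where s = "{0..}"]) (use f that in auto)
      then show ?thesis
        using that at_within_open[of x "{0<..}"] by simp
    qed
    obtain z where z: "s * (1 - t) < z" "z < s" "f s - f (s * (1 - t)) = (s - s * (1 - t)) * f' z"
      using MVT2[OF less, of f f'] deriv pos by force
    \<comment> \<open>This puts the mean value point \<open>z\<close> into the interval where the
      derivative is at least \<open>lam\<close> in absolute value.\<close>
    have "s * t \<le> (\<gamma>2 - \<gamma>1) * a"
    proof -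
      have "s * t \<le> (\<gamma>2 * \<delta>) * a"
        using mult_left_mono[OF \<open>t \<le> \<delta>\<close>, of s] s(1) by (simp add: s_def mult_ac)
      also have "\<dots> \<le> (\<gamma>2 - \<gamma>1) * a"
        using \<delta>(3) \<open>a > 0\<close> by (intro mult_right_mono) auto
      finally show ?thesis .
    qed
    then have "z \<in> {\<gamma>1 * a..\<gamma>2 * a}"
      using z(1,2) by (simp add: s_def algebra_simps)
    then have "s * t * lam \<le> \<bar>f s - f (s * (1 - t))\<bar>"
      unfolding z(3) using f' s t0 by (auto simp: abs_mult algebra_simps intro!: mult_left_mono)
    then have diff: "real d * (s * t * lam) \<le> real d * \<bar>f s - f (s * (1 - t))\<bar>"
      by (rule mult_left_mono) simp
    define q where "q = sqrt (real d / real n)"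
    have q0: "q > 0"
      using d(1) \<open>n \<ge> 1\<close> by (simp add: q_def)
    \<comment> \<open>Turns the separation \<open>d lam s t\<close> into a multiple of
      \<open>a sqrt (d / n)\<close>.\<close>
    have "real d * t = \<delta> * q"
    proof -
      have "real d = sqrt (real d) * sqrt (real d)"
        by simp
      then show ?thesis
        using d(1) \<open>n \<ge> 1\<close> by (simp add: t_def q_def real_sqrt_mult real_sqrt_divide field_simps)
    qed
    then have diff': "lam * \<gamma>2 * \<delta> * a * q \<le> real d * \<bar>f s - f (s * (1 - t))\<bar>"
      using diff by (simp add: s_def mult_ac)
    \<comment> \<open>The factor \<open>sqrt 2\<close> coming from \<open>r \<le> 2 d\<close> is
      rounded up to 2.\<close>
    have "sqrt (r / real n) \<le> 2 * q"
    proof -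
      have "sqrt (r / real n) \<le> sqrt (2\<^sup>2 * (real d / real n))"
        using d by (intro real_sqrt_le_mono) (simp add: divide_right_mono)
      also have "\<dots> = 2 * q"
        unfolding q_def real_sqrt_mult[of "2\<^sup>2"] by simp
      finally show ?thesis .
    qed
    then have "2 * (\<kappa> * a * sqrt (r / real n)) \<le> 2 * (\<kappa> * a * (2 * q))"
      using \<open>\<kappa> > 0\<close> \<open>a > 0\<close> by (intro mult_left_mono) auto
    also have "\<dots> = 1/2 * (lam * \<gamma>2 * \<delta> * a * q)"
      by (simp add: \<kappa>_def)
    also have "\<dots> < 3/4 * (lam * \<gamma>2 * \<delta> * a * q)"
      using assms \<open>\<gamma>2 > 0\<close> \<delta> \<open>a > 0\<close> q0 by (intro mult_strict_right_mono) auto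
    also have "\<dots> \<le> 3/4 * (real d * \<bar>f s - f (s * (1 - t))\<bar>)"
      using diff' by (intro mult_left_mono) auto
    finally show ?thesis
      using C CH H d s t0 dnt \<open>t \<le> \<delta>\<close> \<delta> \<open>\<kappa> > 0\<close> \<open>a > 0\<close> \<open>r \<ge> 1\<close> \<open>n \<ge> 1\<close>
      by (intro minimax_rmse_ge[of C H r s a t n]) auto
  qed
  ultimately show ?thesis
    by blast
qed

end
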